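(* For each natural number $n\ge 2$ there exists a set $\Omega_n=\{z_1,\dots,z_n\}$ of $n$ distinct points in $\mathbb{C}$ such that the minimal degree of a complex polynomial whose Newton map has $\Omega_n$ as a super-attracting cycle is exactly $n+1$; that is, some polynomial $p$ of degree $n+1$ has $\Omega_n$ as a super-attracting cycle for $N_p$, and every polynomial $p$ having $\Omega_n$ as a super-attracting cycle for $N_p$ has degree at least $n+1$.
   Context: For a complex polynomial $p$, the Newton map is the rational map $N_p:\widehat{\mathbb{C}}\to\widehat{\mathbb{C}}$, $N_p(z)=z-\frac{p(z)}{p'(z)}$, where $\widehat{\mathbb{C}}$ is the Riemann sphere. For a rational map $N$ and distinct points $z_1,\dots,z_n$ (listed in this order), the set $\{z_1,\dots,z_n\}$ is a cycle for $N$ if $N(z_i)=z_{i+1}$ for $1\le i\le n$, where $z_{n+1}:=z_1$. The cycle is super-attracting if its multiplier $\lambda=\prod_{i=1}^n N'(z_i)$ equals $0$. *)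

theory Defs
  imports "HOL-Analysis.Analysis" "HOL-Computational_Algebra.Computational_Algebra"
    "HOL-Computational_Algebra.Field_as_Ring"
begin

datatype riemann_sphere = Fin complex | Infty

text \<open>Rational functions are elements of the fraction field \<^typ>\<open>complex poly fract\<close>.
  \<^const>\<open>quot_of_fract\<close> returns a coprime numerator and denominator, so that common zeros
  are cancelled before evaluation.\<close>

definition rat_num :: "complex poly fract \<Rightarrow> complex poly" where
  "rat_num N = fst (quot_of_fract N)"

definition rat_den :: "complex poly fract \<Rightarrow> complex poly" where
  "rat_den N = snd (quot_of_fract N)"

text \<open>In the value at infinity the coefficient of the numerator is \<open>0\<close> if its degree is
  smaller than that of the denominator.\<close>

fun rat_map :: "complex poly fract \<Rightarrow> riemann_sphere \<Rightarrow> riemann_sphere" where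
  "rat_map N (Fin z) =
     (if poly (rat_den N) z = 0 then Infty
      else Fin (poly (rat_num N) z / poly (rat_den N) z))"
| "rat_map N Infty =
     (if degree (rat_num N) > degree (rat_den N) then Infty
      else Fin (coeff (rat_num N) (degree (rat_den N)) / lead_coeff (rat_den N)))"

text \<open>The derivative in the affine coordinate; only meaningful at points that are not poles.\<close>

definition rat_deriv :: "complex poly fract \<Rightarrow> complex \<Rightarrow> complex" where
  "rat_deriv N z = deriv (\<lambda>w. poly (rat_num N) w / poly (rat_den N) w) z"

text \<open>The Newton map is only of interest for non-constant \<open>p\<close>. For constant \<open>p\<close> the convention
  \<open>x / 0 = 0\<close> makes it the identity, which has no cycle of two or more points.\<close>

definition newton_map :: "complex poly \<Rightarrow> complex poly fract" where
  "newton_map p = to_fract [:0, 1:] - to_fract p / to_fract (pderiv p)"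

text \<open>The points \<open>z 1, \<dots>, z n\<close> form a cycle in this listed order.\<close>

definition is_cycle :: "complex poly fract \<Rightarrow> nat \<Rightarrow> (nat \<Rightarrow> complex) \<Rightarrow> bool" where
  "is_cycle N n z \<longleftrightarrow> inj_on z {1..n} \<and>
     (\<forall>i\<in>{1..n}. rat_map N (Fin (z i)) = Fin (z (if i = n then 1 else i + 1)))"

definition multiplier :: "complex poly fract \<Rightarrow> nat \<Rightarrow> (nat \<Rightarrow> complex) \<Rightarrow> complex" where
  "multiplier N n z = (\<Prod>i=1..n. rat_deriv N (z i))"

definition super_attracting_cycle ::
    "complex poly fract \<Rightarrow> nat \<Rightarrow> (nat \<Rightarrow> complex) \<Rightarrow> bool" where
  "super_attracting_cycle N n z \<longleftrightarrow> is_cycle N n z \<and> multiplier N n z = 0"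

end

theory Submission
  imports Defs
begin

text \<open>
  Away from the roots of a nonconstant \<open>p\<close>, the Newton map sends \<open>x\<close> to \<open>y\<close> iff
  \<open>p(x) = (x - y) p'(x)\<close>, which is linear in \<open>p\<close>, and its derivative \<open>p p'' / p'\<^sup>2\<close> at
  such an \<open>x\<close>, if finite, vanishes iff \<open>p''(x) = 0\<close>. A super-attracting cycle of length \<open>n\<close> thus imposes \<open>n + 1\<close> linear
  conditions. For a well chosen cycle they have no nonzero solution among the \<open>n + 1\<close>
  coefficients of a polynomial of degree at most \<open>n\<close>, while one more coefficient leaves room
  for a solution.

  The choice that makes the system solvable by hand is \<open>z\<^sub>i = \<omega>\<^sup>i\<close> with \<open>\<omega>\<close> a primitive \<open>n\<close>-th
  root of unity. The next point after \<open>x\<close> is then \<open>\<omega> x\<close>, and the cycle conditions say that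
  \<open>p - (1 - \<omega>) x p'\<close> vanishes at all \<open>n\<close>-th roots of unity. This operator is diagonal:
  it multiplies the coefficient \<open>a\<^sub>k\<close> of \<open>x\<^sup>k\<close> by \<open>c\<^sub>k = 1 - (1 - \<omega>) k\<close>, which is never \<open>0\<close>
  because \<open>\<bar>\<omega>\<bar> = 1\<close> (lemma \<open>one_minus_multiple_nonzero\<close>). Modulo \<open>x\<^sup>n - 1\<close> the system decouples:

  \<^item> In degree at most \<open>n\<close> it reads \<open>c\<^sub>0 a\<^sub>0 + c\<^sub>n a\<^sub>n = 0\<close> and \<open>a\<^sub>k = 0\<close> for \<open>0 < k < n\<close>, so
    \<open>p = a\<^sub>n (x\<^sup>n - c\<^sub>n)\<close> (lemma \<open>low_degree_form\<close>). None of \<open>p\<close>, \<open>p'\<close>, \<open>p''\<close> vanishes on the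
    cycle, hence the multiplier is not \<open>0\<close>.

  \<^item> In degree \<open>n + 1\<close> the additional relation \<open>c\<^sub>1 a\<^sub>1 + c\<^sub>n\<^sub>+\<^sub>1 a\<^sub>n\<^sub>+\<^sub>1 = 0\<close>, with \<open>c\<^sub>1 = \<omega>\<close>,
    allows adding a multiple of \<open>c\<^sub>n\<^sub>+\<^sub>1 x - \<omega> x\<^sup>n\<^sup>+\<^sup>1\<close>. The ratio of the two summands can be
    adjusted so that \<open>p''\<close> vanishes at \<open>z\<^sub>n = 1\<close>.
\<close>

section \<open>Newton maps as rational functions\<close>

lemma rat_num_div_rat_den: "to_fract (rat_num N) / to_fract (rat_den N) = N"
  unfolding rat_num_def rat_den_def
  by (metis Fract_conv_to_fract Fract_quot_of_fract prod.collapse)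

lemma newton_quot:
  assumes "pderiv p \<noteq> 0"
  shows "rat_num (newton_map p) * pderiv p = rat_den (newton_map p) * ([:0, 1:] * pderiv p - p)"
proof -
  let ?a = "rat_num (newton_map p)" and ?b = "rat_den (newton_map p)"
  have b: "?b \<noteq> 0" by (simp add: rat_den_def)
  have "to_fract ?a / to_fract ?b = newton_map p" by (rule rat_num_div_rat_den)
  hence "to_fract ?a * to_fract (pderiv p) =
      to_fract ?b * (to_fract [:0, 1:] * to_fract (pderiv p) - to_fract p)"
    using b assms by (simp add: newton_map_def field_simps)
  hence "to_fract (?a * pderiv p) = to_fract (?b * ([:0, 1:] * pderiv p - p))"
    by (simp only: to_fract_mult to_fract_diff)
  thus ?thesis by (simp only: to_fract_eq_iff)
qed

text \<open>For constant \<open>p\<close> the Newton map is the identity, so it does not move any point of a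
  cycle.\<close>

lemma newton_map_constant:
  assumes "pderiv p = 0" "rat_map (newton_map p) (Fin x) = Fin y"
  shows "y = x"
proof -
  let ?a = "rat_num (newton_map p)" and ?b = "rat_den (newton_map p)"
  have b: "?b \<noteq> 0" by (simp add: rat_den_def)
  have "to_fract ?a / to_fract ?b = newton_map p" by (rule rat_num_div_rat_den)
  hence "to_fract ?a = to_fract ?b * to_fract [:0, 1:]"
    using b assms(1) by (simp add: newton_map_def field_simps)
  hence "to_fract ?a = to_fract (?b * [:0, 1:])" by (simp only: to_fract_mult)
  hence "?a = ?b * [:0, 1:]" by (simp only: to_fract_eq_iff)
  hence "poly ?a x = poly ?b x * x" by simp
  with assms(2) show ?thesis by (auto split: if_splits)
qed

text \<open>Clearing denominators keeps the equation valid even where \<open>p\<close> and \<open>p'\<close> vanish together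
  and the quotient \<open>p / p'\<close> has a cancelled singularity. So the linear equation can be read off
  a cycle before anything is known about the zeros of \<open>p\<close> and \<open>p'\<close>.\<close>

lemma newton_map_step:
  assumes "pderiv p \<noteq> 0" "rat_map (newton_map p) (Fin x) = Fin y"
  shows "poly p x = (x - y) * poly (pderiv p) x"
proof -
  let ?a = "rat_num (newton_map p)" and ?b = "rat_den (newton_map p)"
  from assms(2) have b: "poly ?b x \<noteq> 0" and a: "poly ?a x = y * poly ?b x"
    by (auto split: if_splits)
  have "poly ?a x * poly (pderiv p) x = poly ?b x * (x * poly (pderiv p) x - poly p x)"
    using arg_cong[OF newton_quot[OF assms(1)], of "\<lambda>q. poly q x"] by simp
  hence "poly ?b x * (y * poly (pderiv p) x) = poly ?b x * (x * poly (pderiv p) x - poly p x)"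
    by (simp add: a mult_ac)
  hence "y * poly (pderiv p) x = x * poly (pderiv p) x - poly p x"
    using b by (simp only: mult_cancel_left) simp
  thus ?thesis by (simp add: algebra_simps)
qed

text \<open>By the cross-multiplied equation, a zero of the denominator that is not a zero of \<open>p'\<close> would
  be a zero of the coprime numerator as well.\<close>

lemma newton_den_nonzero:
  assumes "poly (pderiv p) x \<noteq> 0"
  shows "poly (rat_den (newton_map p)) x \<noteq> 0"
proof
  let ?a = "rat_num (newton_map p)" and ?b = "rat_den (newton_map p)"
  assume b: "poly ?b x = 0"
  have "pderiv p \<noteq> 0" using assms by auto
  from arg_cong[OF newton_quot[OF this], of "\<lambda>q. poly q x"] b assms
  have "poly ?a x = 0" by simp
  with b have "[:- x, 1:] dvd ?a" "[:- x, 1:] dvd ?b" by (simp_all add: poly_eq_0_iff_dvd)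
  moreover have "coprime ?a ?b"
    unfolding rat_num_def rat_den_def by (rule coprime_quot_of_fract)
  ultimately have "is_unit [:- x, 1:]" by (rule coprime_common_divisor[rotated])
  thus False by (simp add: is_unit_iff_degree)
qed

lemma newton_quotient_eq:
  assumes "poly (pderiv p) x \<noteq> 0"
  shows "poly (rat_num (newton_map p)) x / poly (rat_den (newton_map p)) x
           = x - poly p x / poly (pderiv p) x"
proof -
  have "pderiv p \<noteq> 0" using assms by auto
  from arg_cong[OF newton_quot[OF this], of "\<lambda>q. poly q x"]
    newton_den_nonzero[OF assms] assms
  show ?thesis by (simp add: field_simps)
qed

lemma newton_rat_map:
  assumes "poly (pderiv p) x \<noteq> 0"
  shows "rat_map (newton_map p) (Fin x) = Fin (x - poly p x / poly (pderiv p) x)"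
  using newton_den_nonzero[OF assms] newton_quotient_eq[OF assms] by simp

lemma newton_rat_deriv:
  assumes "poly (pderiv p) x \<noteq> 0"
  shows "rat_deriv (newton_map p) x =
           poly p x * poly (pderiv (pderiv p)) x / (poly (pderiv p) x)\<^sup>2"
proof -
  have "open {w. poly (pderiv p) w \<noteq> 0}"
    by (intro open_Collect_neq continuous_intros)
  hence "\<forall>\<^sub>F w in nhds x. poly (pderiv p) w \<noteq> 0"
    using assms by (auto simp: eventually_nhds)
  hence "\<forall>\<^sub>F w in nhds x. poly (rat_num (newton_map p)) w / poly (rat_den (newton_map p)) w
           = w - poly p w / poly (pderiv p) w"
    by eventually_elim (rule newton_quotient_eq)
  hence "rat_deriv (newton_map p) x = deriv (\<lambda>w. w - poly p w / poly (pderiv p) w) x"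
    unfolding rat_deriv_def by (rule deriv_cong_ev) simp
  also have "\<dots> = poly p x * poly (pderiv (pderiv p)) x / (poly (pderiv p) x)\<^sup>2"
    by (rule DERIV_imp_deriv)
       (use assms in \<open>auto intro!: derivative_eq_intros simp: field_simps power2_eq_square\<close>)
  finally show ?thesis .
qed

section \<open>Cycles of roots of unity\<close>

text \<open>A zero would mean \<open>k \<omega> = k - 1\<close>, so \<open>k = \<bar>k - 1\<bar>\<close>, which only \<open>k = 1/2\<close> satisfies.\<close>

lemma one_minus_multiple_nonzero:
  fixes \<omega> :: complex
  assumes "norm \<omega> = 1"
  shows "1 - (1 - \<omega>) * of_nat k \<noteq> 0"
proof
  assume "1 - (1 - \<omega>) * of_nat k = 0"
  hence "\<omega> * of_nat k = of_real (real k - 1)" by (simp add: algebra_simps)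
  hence "norm (\<omega> * of_nat k) = \<bar>real k - 1\<bar>" by (simp only: norm_of_real)
  hence "real k = \<bar>real k - 1\<bar>" using assms by (simp add: norm_mult)
  hence "2 * real k = 1" by linarith
  hence "real (2 * k) = real 1" by simp
  hence "2 * k = 1" by (simp only: of_nat_eq_iff)
  thus False by presburger
qed

lemma inj_on_powers_of_root:
  fixes \<omega> :: complex
  assumes "norm \<omega> = 1" and prim: "\<And>k. 0 < k \<Longrightarrow> k < n \<Longrightarrow> \<omega> ^ k \<noteq> 1"
  shows "inj_on (\<lambda>i. \<omega> ^ i) {1..n}"
proof (rule linorder_inj_onI)
  fix i j assume ij: "i < j" "i \<in> {1..n}" "j \<in> {1..n}"
  have "\<omega> \<noteq> 0" using assms(1) by auto
  have "\<omega> ^ j = \<omega> ^ i * \<omega> ^ (j - i)" using ij by (simp flip: power_add)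
  with prim[of "j - i"] ij \<open>\<omega> \<noteq> 0\<close> show "\<omega> ^ i \<noteq> \<omega> ^ j" by auto
qed auto

text \<open>Subtracting the right multiple of \<open>x\<^sup>n - 1\<close> leaves a polynomial of degree less than \<open>n\<close>
  with \<open>n\<close> roots.\<close>

lemma vanishing_at_roots_of_unity:
  fixes \<omega> :: complex
  assumes n: "n \<ge> 1" and \<omega>: "\<omega> ^ n = 1" and inj: "inj_on (\<lambda>i. \<omega> ^ i) {1..n}"
    and deg: "degree q \<le> n" and van: "\<And>i. i \<in> {1..n} \<Longrightarrow> poly q (\<omega> ^ i) = 0"
  shows "q = smult (coeff q n) (monom 1 n - 1)"
proof (rule ccontr)
  define r where "r = q - smult (coeff q n) (monom 1 n - 1)"
  assume "\<not> ?thesis"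
  hence r0: "r \<noteq> 0" by (simp add: r_def)
  have "poly r (\<omega> ^ i) = 0" if "i \<in> {1..n}" for i
  proof -
    have "(\<omega> ^ i) ^ n = 1" by (metis \<omega> power_commutes power_mult mult.commute power_one)
    with van[OF that] show ?thesis by (simp add: r_def poly_monom)
  qed
  hence sub: "(\<lambda>i. \<omega> ^ i) ` {1..n} \<subseteq> {x. poly r x = 0}" by auto
  have "n = card ((\<lambda>i. \<omega> ^ i) ` {1..n})" using card_image[OF inj] by simp
  also have "\<dots> \<le> card {x. poly r x = 0}" by (rule card_mono[OF poly_roots_finite[OF r0] sub])
  also have "\<dots> \<le> degree r" by (rule card_poly_roots_bound[OF r0])
  finally have "n \<le> degree r" .
  moreover have "degree r \<le> n"
    unfolding r_def
    by (intro degree_diff_le deg order.trans[OF degree_smult_le] degree_monom_le) simp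
  ultimately have "degree r = n" by simp
  moreover have "coeff r n = 0" using n by (simp add: r_def)
  ultimately show False using r0 leading_coeff_0_iff by metis
qed

text \<open>The polynomial \<open>q = p - (1 - \<omega>) x p'\<close> vanishes at the roots of unity, so it is a multiple
  of \<open>x\<^sup>n - 1\<close>; since its coefficients are nonzero multiples of those of \<open>p\<close>, comparing
  coefficients determines \<open>p\<close> up to a scalar.\<close>

lemma low_degree_form:
  fixes \<omega> :: complex
  assumes n: "n \<ge> 1" and nrm: "norm \<omega> = 1" and \<omega>: "\<omega> ^ n = 1"
    and inj: "inj_on (\<lambda>i. \<omega> ^ i) {1..n}"
    and deg: "degree p \<le> n"
    and step: "\<And>i. i \<in> {1..n} \<Longrightarrow>
      poly p (\<omega> ^ i) = (\<omega> ^ i - \<omega> * \<omega> ^ i) * poly (pderiv p) (\<omega> ^ i)"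
  shows "p = smult (coeff p n) (monom 1 n - [:1 - (1 - \<omega>) * of_nat n:])"
proof -
  define q where "q = p - smult (1 - \<omega>) (pCons 0 (pderiv p))"
  have cq: "coeff q k = (1 - (1 - \<omega>) * of_nat k) * coeff p k" for k
    by (cases k) (simp_all add: q_def coeff_pderiv algebra_simps)
  have "degree q \<le> n"
    by (rule degree_le) (use deg in \<open>auto simp: cq coeff_eq_0\<close>)
  moreover have "poly q (\<omega> ^ i) = 0" if "i \<in> {1..n}" for i
    using step[OF that] by (simp add: q_def algebra_simps)
  ultimately have q: "q = smult (coeff q n) (monom 1 n - 1)"
    by (intro vanishing_at_roots_of_unity[OF n \<omega> inj]) auto
  show ?thesis
  proof (rule poly_eqI)
    fix k
    have eq: "(1 - (1 - \<omega>) * of_nat k) * coeff p k =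
        (1 - (1 - \<omega>) * of_nat n) * coeff p n * ((if k = n then 1 else 0) - (if k = 0 then 1 else 0))"
      using arg_cong[OF q, of "\<lambda>r. coeff r k"] by (auto simp: cq)
    show "coeff p k = coeff (smult (coeff p n) (monom 1 n - [:1 - (1 - \<omega>) * of_nat n:])) k"
    proof (cases "k = 0 \<or> k = n")
      case True
      with eq n show ?thesis by (auto simp: algebra_simps coeff_pCons split: nat.splits)
    next
      case False
      with eq one_minus_multiple_nonzero[OF nrm, of k] have "coeff p k = 0" by simp
      with False show ?thesis by (simp add: coeff_pCons split: nat.splits)
    qed
  qed
qed

theorem mainTheorem4:
  fixes n :: nat
  assumes "n \<ge> 2"
  shows "\<exists>z :: nat \<Rightarrow> complex. inj_on z {1..n} \<and>
           (\<exists>p :: complex poly. degree p = n + 1 \<and> super_attracting_cycle (newton_map p) n z) \<and>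
           (\<forall>p :: complex poly. super_attracting_cycle (newton_map p) n z \<longrightarrow> n + 1 \<le> degree p)"
proof -
  define \<omega> where "\<omega> = cis (2 * pi / real n)"
  define z where "z = (\<lambda>i::nat. \<omega> ^ i)"
  have nrm: "norm \<omega> = 1" by (simp add: \<omega>_def)
  have pow: "\<omega> ^ k = cis (2 * pi * real k / real n)" for k
    unfolding \<omega>_def Complex.DeMoivre by (rule arg_cong[of _ _ cis]) simp
  have \<omega>n: "\<omega> ^ n = 1" using assms by (simp add: pow)
  have prim: "\<omega> ^ k \<noteq> 1" if "0 < k" "k < n" for k
  proof
    assume "\<omega> ^ k = 1"
    moreover have "inj_on (\<lambda>k. cis (2 * pi * real k / real n)) {..<n}"
      using Complex.bij_betw_roots_unity[of n] assms by (auto simp: bij_betw_def)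
    ultimately have "k = 0" using that by (auto simp: pow dest: inj_onD[of _ _ k 0])
    with that show False by simp
  qed
  have inj: "inj_on z {1..n}"
    unfolding z_def by (rule inj_on_powers_of_root[OF nrm prim])
  have \<omega>1: "\<omega> \<noteq> 1" using prim[of 1] assms by simp
  have \<omega>0: "\<omega> \<noteq> 0" using nrm by auto
  have next_z: "z (if i = n then 1 else i + 1) = \<omega> * z i" for i
    using \<omega>n by (simp add: z_def)
  have z0: "z i \<noteq> 0" for i using \<omega>0 by (simp add: z_def)
  have nz: "norm (z i) = 1" for i using nrm by (simp add: z_def norm_power)
  have zn: "z i ^ n = 1" for i
    unfolding z_def by (metis \<omega>n power_mult mult.commute power_one)

  define c where "c = (\<lambda>k::nat. 1 - (1 - \<omega>) * of_nat k)"
  \<comment> \<open>Both summands satisfy the linear conditions. Their second derivatives at \<open>1\<close> are \<open>n (n - 1)\<close>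
    and \<open>- \<omega> (n + 1) n\<close>, which cancel with the weights \<open>(n + 1) \<omega>\<close> and \<open>n - 1\<close>.\<close>
  define p where "p = smult (of_nat (n + 1) * \<omega>) (monom 1 n - [:c n:])
      + smult (of_nat (n - 1)) ([:0, c (n + 1):] - monom \<omega> (n + 1))"
  have cp: "coeff p (n + 1) = - (of_nat (n - 1) * \<omega>)"
    using assms by (simp add: p_def coeff_pCons split: nat.splits)
  have "degree p \<le> n + 1"
    by (rule degree_le) (use assms in \<open>auto simp: p_def coeff_pCons split: nat.splits\<close>)
  moreover have "coeff p (n + 1) \<noteq> 0" unfolding cp using \<omega>0 assms by simp
  ultimately have degp: "degree p = n + 1" using le_degree by (metis le_antisym)
  have nn: "of_nat (n - 1) = (of_nat n - 1 :: complex)" using assms by (simp add: of_nat_diff)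
  have pz: "poly p (z i) = of_nat n * (1 - \<omega>) * (of_nat (n + 1) * \<omega> - of_nat (n - 1) * z i)" for i
    using zn[of i] by (simp add: p_def poly_monom c_def nn algebra_simps)
  \<comment> \<open>The terms \<open>(n + 1) \<omega>\<close> and \<open>(n - 1) z\<^sub>i\<close> have different absolute values, so they cannot
    cancel.\<close>
  have pz0: "poly p (z i) \<noteq> 0" for i
  proof
    assume "poly p (z i) = 0"
    hence "of_nat (n + 1) * \<omega> = of_nat (n - 1) * z i"
      using \<omega>1 assms by (simp add: pz)
    hence "norm (of_nat (n + 1) * \<omega>) = norm (of_nat (n - 1) * z i)" by (rule arg_cong)
    hence "real (n + 1) = real (n - 1)" by (simp only: norm_mult nrm nz norm_of_nat mult_1_right)
    thus False by simp
  qed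
  have step: "poly p (z i) = (z i - \<omega> * z i) * poly (pderiv p) (z i)" for i
  proof -
    have "z i * poly (pderiv p) (z i) =
       of_nat (n + 1) * \<omega> * of_nat n * z i ^ n
        + of_nat (n - 1) * (c (n + 1) * z i - \<omega> * of_nat (n + 1) * (z i * z i ^ n))"
      using assms by (simp add: p_def pderiv_add pderiv_smult pderiv_diff pderiv_monom pderiv_pCons
          poly_monom power_eq_if algebra_simps)
    hence "z i * poly (pderiv p) (z i) =
       of_nat n * (of_nat (n + 1) * \<omega> - of_nat (n - 1) * z i)"
      unfolding zn by (simp add: c_def nn algebra_simps)
    hence "(1 - \<omega>) * (z i * poly (pderiv p) (z i)) = poly p (z i)"
      unfolding pz by (simp only: mult_ac)
    thus ?thesis by (simp add: algebra_simps)
  qed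
  have dp0: "poly (pderiv p) (z i) \<noteq> 0" for i using step[of i] pz0[of i] by auto
  have "rat_map (newton_map p) (Fin (z i)) = Fin (\<omega> * z i)" for i
    using step[of i] dp0[of i] by (simp add: newton_rat_map del: rat_map.simps)
  hence cyc: "is_cycle (newton_map p) n z"
    using inj by (simp add: is_cycle_def next_z del: rat_map.simps)
  have "poly (pderiv (pderiv p)) 1 = 0"
    using assms by (simp add: p_def pderiv_add pderiv_smult pderiv_diff pderiv_monom pderiv_pCons
          poly_monom nn algebra_simps)
  moreover have "z n = 1" using \<omega>n by (simp add: z_def)
  ultimately have "rat_deriv (newton_map p) (z n) = 0"
    using newton_rat_deriv[OF dp0[of n]] by simp
  hence "multiplier (newton_map p) n z = 0"
    unfolding multiplier_def using assms by (intro prod_zero) auto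
  with cyc have ex: "super_attracting_cycle (newton_map p) n z"
    by (simp add: super_attracting_cycle_def)

  have lower: "n + 1 \<le> degree p" if sac: "super_attracting_cycle (newton_map p) n z" for p
  proof (rule ccontr)
    assume "\<not> n + 1 \<le> degree p"
    hence deg: "degree p \<le> n" by simp
    have map: "rat_map (newton_map p) (Fin (z i)) = Fin (\<omega> * z i)" if "i \<in> {1..n}" for i
      using sac that by (auto simp: super_attracting_cycle_def is_cycle_def next_z
          simp del: rat_map.simps)
    have dp: "pderiv p \<noteq> 0"
      using newton_map_constant[OF _ map[of 1]] assms \<omega>1 z0[of 1] by auto
    define B where "B = coeff p n"
    have p: "p = smult B (monom 1 n - [:1 - (1 - \<omega>) * of_nat n:])"
      unfolding B_def
      by (rule low_degree_form[OF _ nrm \<omega>n _ deg])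
         (use assms inj newton_map_step[OF dp map] in \<open>auto simp: z_def\<close>)
    have B: "B \<noteq> 0" using dp p by auto
    have "poly p (z i) = B * (1 - \<omega>) * of_nat n" for i
      using zn[of i] by (subst p) (simp add: poly_monom algebra_simps)
    hence "poly p (z i) \<noteq> 0" for i using B \<omega>1 assms by simp
    moreover have d: "pderiv p = monom (B * of_nat n) (n - 1)"
      by (subst p) (simp add: pderiv_smult pderiv_diff pderiv_monom pderiv_pCons smult_monom)
    hence "poly (pderiv p) (z i) \<noteq> 0" for i using B assms z0 by (simp add: poly_monom)
    moreover have "poly (pderiv (pderiv p)) (z i) \<noteq> 0" for i
      unfolding d using B assms z0 by (simp add: poly_monom pderiv_monom)
    ultimately have "rat_deriv (newton_map p) (z i) \<noteq> 0" for i
      by (simp add: newton_rat_deriv)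
    hence "multiplier (newton_map p) n z \<noteq> 0" by (simp add: multiplier_def)
    with sac show False by (simp add: super_attracting_cycle_def)
  qed
  show ?thesis using inj degp ex lower by blast
qed

end
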